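(* Let $\bm{A}_f\in\mathbb{R}^{m\times n}$, let $\bm{D}\in\mathbb{R}^{n\times n_c}$ be a deterministic sketch matrix, and let $\bm{A}_c=\bm{A}_f\bm{D}\in\mathbb{R}^{m\times n_c}$ be the coarse grid data matrix. Let $\hat{\bm{A}}_f=\bm{P}_c\bm{A}_c(\mathcal{I}_c,:)\bm{T}_r$ be the rank-$k$ approximation of $\bm{A}_f$ generated by SPC-ID (defined in the context), where $\bm{P}_c\bm{A}_c(\mathcal{I}_c,:)$ is the rank-$k$ row interpolative decomposition approximation of $\bm{A}_c$ and the lifting operator rank $r$ is the minimizing one in the bound below. Let $\sigma_{c,j}$ be the $j$-th largest singular value of $\bm{A}_c$, and for $\tau>0$ let $$\epsilon(\tau)=\lambda_{\max}\left(\bm{A}_f\bm{A}_f^T-\tau\bm{A}_c\bm{A}_c^T\right).$$ Then $$\Vert\bm{A}_f-\hat{\bm{A}}_f\Vert_2\le\min_{\tau,\;k\le r\le\operatorname{rank}(\bm{A}_c)}\left(\epsilon(\tau)+\tau\sigma_{c,r+1}^2\right)^{1/2}+\Vert\bm{A}_c-\bm{P}_c\bm{A}_c(\mathcal{I}_c,:)\Vert_2\left(\tau+\epsilon(\tau)\sigma_{c,r}^{-2}\right)^{1/2},$$ where the minimum is of the whole two-term expression on the right, over $\tau>0$ and integers $r$ with $k\le r\le\operatorname{rank}(\bm{A}_c)$.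
   Context: $\Vert\cdot\Vert_2$ is the matrix 2-norm, $\lambda_{\max}$ the largest eigenvalue of a symmetric matrix, ${}^+$ the Moore-Penrose pseudoinverse. $\bm{A}(\mathcal{I},:)$ denotes the submatrix of rows of $\bm{A}$ indexed by $\mathcal{I}$. $\sigma_{c,r+1}$ is $0$ when $r=\operatorname{rank}(\bm{A}_c)$. Row interpolative decomposition (row ID): a rank-$k$ row ID of $\bm{A}_c\in\mathbb{R}^{m\times n_c}$ is an approximation $\bm{A}_c\approx\bm{P}_c\bm{A}_c(\mathcal{I}_c,:)$ with $\mathcal{I}_c\subseteq\{1,\dots,m\}$, $|\mathcal{I}_c|=k$, and a coefficient matrix $\bm{P}_c\in\mathbb{R}^{m\times k}$ such that $\bm{P}_c(\mathcal{I}_c,:)$ is the $k\times k$ identity. SPC-ID (single-pass coarse grid interpolative decomposition, without the optional random projection): form $\bm{A}_c=\bm{A}_f\bm{D}$ and $\bm{H}=\bm{A}_f^T\bm{A}_c$; compute an SVD $\bm{A}_c=\bm{U}_c\bm{S}_c\bm{V}_c^T$ with non-increasing singular values, and let $\tilde{\bm{U}}_r$ be the first $r$ columns of $\bm{U}_c$; form the lifting operator $$\bm{T}_r=\bm{V}_c\bm{S}_c^{+}\bm{U}_c^T\tilde{\bm{U}}_r\tilde{\bm{U}}_r^T\bm{U}_c\bm{S}_c^{+}\bm{V}_c^T\bm{H}^T=\bm{A}_c^{+}\tilde{\bm{U}}_r\tilde{\bm{U}}_r^T\bm{A}_f;$$ compute a rank-$k$ row ID $\bm{P}_c\bm{A}_c(\mathcal{I}_c,:)$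 of $\bm{A}_c$; output $\hat{\bm{A}}_f=\bm{P}_c\bm{A}_c(\mathcal{I}_c,:)\bm{T}_r$. The integer $r$ is a parameter of the algorithm with $k\le r\le\operatorname{rank}(\bm{A}_c)$.
   Formalization: The minimum is taken as an infimum over τ>0 with ε(τ)≥0 (also in choosing r) and k≥1 is assumed; when A_c has full row rank, τ with ε(τ)<0 make radicands negative or the bound false, while for rank(A_c)<m the condition always holds. *)

theory Defs
  imports
    "HOL-Analysis.Analysis"
    "Jordan_Normal_Form.DL_Rank"
    "Jordan_Normal_Form.DL_Submatrix"
    "Jordan_Normal_Form.Char_Poly"
begin

text \<open>
  Indices of matrices start at 0, while singular values are numbered from 1.
\<close>

definition euclid_norm :: "real vec \<Rightarrow> real" where
  "euclid_norm v = sqrt (v \<bullet> v)"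

text \<open>The supremum is over the closed unit ball, so that it is \<open>0\<close> for a matrix without columns.\<close>

definition norm2 :: "real mat \<Rightarrow> real" where
  "norm2 A = (SUP v \<in> {v \<in> carrier_vec (dim_col A). euclid_norm v \<le> 1}. euclid_norm (A *\<^sub>v v))"

text \<open>For use with symmetric matrices, whose eigenvalues are all real.\<close>

definition lambda_max :: "real mat \<Rightarrow> real" where
  "lambda_max A = Max {x. eigenvalue A x}"

definition is_pinv :: "real mat \<Rightarrow> real mat \<Rightarrow> bool" where
  "is_pinv A X \<longleftrightarrow>
     X \<in> carrier_mat (dim_col A) (dim_row A) \<and>
     A * X * A = A \<and> X * A * X = X \<and>
     transpose_mat (A * X) = A * X \<and> transpose_mat (X * A) = X * A"

definition pinv :: "real mat \<Rightarrow> real mat" where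
  "pinv A = (THE X. is_pinv A X)"

text \<open>
  The economy-size SVD with \<open>p = min m n\<close>; with it \<open>S\<close> is square, as the product of
  factors in \<open>lifting_op\<close> below requires.
\<close>

definition is_svd :: "real mat \<Rightarrow> real mat \<Rightarrow> real mat \<Rightarrow> real mat \<Rightarrow> bool" where
  "is_svd A U S V \<longleftrightarrow>
     (let m = dim_row A; n = dim_col A; p = min m n in
        U \<in> carrier_mat m p \<and> S \<in> carrier_mat p p \<and> V \<in> carrier_mat n p \<and>
        transpose_mat U * U = 1\<^sub>m p \<and> transpose_mat V * V = 1\<^sub>m p \<and>
        diagonal_mat S \<and>
        (\<forall>i < p. 0 \<le> S $$ (i, i)) \<and>
        (\<forall>i j. i \<le> j \<and> j < p \<longrightarrow> S $$ (j, j) \<le> S $$ (i, i)) \<and>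
        A = U * S * transpose_mat V)"

text \<open>
  The \<open>j\<close>-th largest singular value (\<open>j \<ge> 1\<close>), read off the factor \<open>S\<close> of an SVD;
  it is \<open>0\<close> beyond the size of \<open>S\<close>.
\<close>

definition sing_val :: "real mat \<Rightarrow> nat \<Rightarrow> real" where
  "sing_val S j = (if 1 \<le> j \<and> j \<le> dim_row S then S $$ (j - 1, j - 1) else 0)"

definition select_rows :: "real mat \<Rightarrow> nat set \<Rightarrow> real mat" where
  "select_rows A I = submatrix A I UNIV"

definition first_cols :: "nat \<Rightarrow> real mat \<Rightarrow> real mat" where
  "first_cols r U = submatrix U UNIV {..<r}"

text \<open>\<open>P * select_rows A I\<close> is a rank-\<open>k\<close> row interpolative decomposition of \<open>A\<close>.\<close>

definition is_row_ID :: "nat \<Rightarrow> real mat \<Rightarrow> nat set \<Rightarrow> real mat \<Rightarrow> bool" where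
  "is_row_ID k A I P \<longleftrightarrow>
     I \<subseteq> {..<dim_row A} \<and> card I = k \<and>
     P \<in> carrier_mat (dim_row A) k \<and>
     select_rows P I = 1\<^sub>m k"

text \<open>
  \<open>V S\<^sup>+ U\<^sup>T U\<^sub>r U\<^sub>r\<^sup>T U S\<^sup>+ V\<^sup>T H\<^sup>T\<close> with \<open>H = A\<^sub>f\<^sup>T A\<^sub>c\<close> and \<open>U\<^sub>r\<close> the first \<open>r\<close> columns of \<open>U\<close>.
\<close>

definition lifting_op ::
  "real mat \<Rightarrow> real mat \<Rightarrow> real mat \<Rightarrow> real mat \<Rightarrow> real mat \<Rightarrow> nat \<Rightarrow> real mat" where
  "lifting_op Af Ac U S V r =
     (let H = transpose_mat Af * Ac; Ur = first_cols r U in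
        V * pinv S * transpose_mat U * Ur * transpose_mat Ur * U * pinv S * transpose_mat V
          * transpose_mat H)"

definition spc_id ::
  "real mat \<Rightarrow> real mat \<Rightarrow> real mat \<Rightarrow> real mat \<Rightarrow> real mat \<Rightarrow> nat set \<Rightarrow> real mat \<Rightarrow> nat \<Rightarrow> real mat"
  where
  "spc_id Af Ac U S V I P r = P * select_rows Ac I * lifting_op Af Ac U S V r"

definition eps :: "real mat \<Rightarrow> real mat \<Rightarrow> real \<Rightarrow> real" where
  "eps Af Ac \<tau> = lambda_max (Af * transpose_mat Af - \<tau> \<cdot>\<^sub>m (Ac * transpose_mat Ac))"

definition error_bound ::
  "real mat \<Rightarrow> real mat \<Rightarrow> real mat \<Rightarrow> nat set \<Rightarrow> real mat \<Rightarrow> real \<Rightarrow> nat \<Rightarrow> real" where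
  "error_bound Af Ac S I P \<tau> r =
     sqrt (eps Af Ac \<tau> + \<tau> * (sing_val S (r + 1))\<^sup>2) +
     norm2 (Ac - P * select_rows Ac I) * sqrt (\<tau> + eps Af Ac \<tau> / (sing_val S r)\<^sup>2)"

text \<open>
  The values of \<open>\<tau>\<close> over which the bound is minimized. The condition \<open>eps \<ge> 0\<close> holds
  automatically if \<open>A\<^sub>c\<close> has rank less than its number of rows. For full row rank it
  excludes large \<open>\<tau>\<close>, where the radicands may be negative and, even when they are not, the
  bound fails: take \<open>A\<^sub>f = diag(3/2, 1/10, 1/10)\<close>, \<open>A\<^sub>c = diag(2, 1, 1)\<close>,
  \<open>I\<close> the last two rows, \<open>P\<close> with first row \<open>0\<close>, \<open>\<tau> = 1\<close>. Then \<open>eps = -99/100\<close>, the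
  bound for \<open>r = k = 2\<close> is \<open>3/10\<close>, and the error is \<open>3/2\<close> for \<open>r = 2\<close> and \<open>r = 3\<close>.
\<close>

definition admissible_taus :: "real mat \<Rightarrow> real mat \<Rightarrow> real set" where
  "admissible_taus Af Ac = {\<tau>. 0 < \<tau> \<and> 0 \<le> eps Af Ac \<tau>}"

end

theory Submission
  imports Defs
begin

text \<open>
  The error is split as
  \<open>A\<^sub>f - P A\<^sub>c(I,:) T = (A\<^sub>f - A\<^sub>c T) + (A\<^sub>c - P A\<^sub>c(I,:)) T\<close>, so it suffices to bound the norms
  of \<open>A\<^sub>f - A\<^sub>c T\<close> and of \<open>T\<close> by the two square roots of the bound
  (\<open>norm2_projection_residual_le\<close>, \<open>norm2_lifting_op_le\<close>).

  Both estimates have the same source. Since the largest eigenvalue of a symmetric matrix bounds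
  its quadratic form (\<open>quadratic_form_le_lambda_max\<close>), every vector \<open>x\<close> satisfies
  \<open>\<bar>A\<^sub>f\<^sup>T x\<bar>\<^sup>2 \<le> \<epsilon>(\<tau>) \<bar>x\<bar>\<^sup>2 + \<tau> \<bar>A\<^sub>c\<^sup>T x\<bar>\<^sup>2\<close> (\<open>eps_bound\<close>). A matrix and its transpose have
  the same 2-norm, and with the SVD \<open>A\<^sub>c = U S V\<^sup>T\<close> and \<open>U\<^sub>r\<close> the first \<open>r\<close> columns of \<open>U\<close>, both
  transposes apply \<open>A\<^sub>f\<^sup>T\<close> to a vector about which everything is known:
  \<^item> \<open>(A\<^sub>f - A\<^sub>c T)\<^sup>T y = A\<^sub>f\<^sup>T z\<close> with \<open>z = y - U\<^sub>r U\<^sub>r\<^sup>T y\<close>, where \<open>\<bar>z\<bar> \<le> \<bar>y\<bar>\<close> and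
    \<open>\<bar>A\<^sub>c\<^sup>T z\<bar> \<le> \<sigma>\<^bsub>r+1\<^esub> \<bar>y\<bar>\<close> because only the singular values after the \<open>r\<close>-th remain;
  \<^item> \<open>T\<^sup>T y = A\<^sub>f\<^sup>T z\<close> with \<open>z = U\<^sub>r S\<^sub>r\<^sup>+ V\<^sub>r\<^sup>T y\<close>, where \<open>\<bar>z\<bar> \<le> \<bar>y\<bar> / \<sigma>\<^sub>r\<close> and
    \<open>\<bar>A\<^sub>c\<^sup>T z\<bar> = \<bar>V\<^sub>r\<^sup>T y\<bar> \<le> \<bar>y\<bar>\<close>.
  The condition \<open>\<epsilon>(\<tau>) \<ge> 0\<close> allows \<open>\<bar>z\<bar>\<close> to be replaced by its upper bound, and \<open>r \<le> rank A\<^sub>c\<close>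
  gives \<open>\<sigma>\<^sub>r > 0\<close> (\<open>rank_le_of_sing_val_zero\<close>).

  This bounds the error for every admissible \<open>\<tau>\<close> at the given \<open>r\<close>, hence by the infimum over \<open>\<tau>\<close>;
  as \<open>r\<close> minimizes that infimum, the bound holds for all other ranks too. Infima of real sets are
  only meaningful for nonempty sets that are bounded below, which is why
  \<open>admissible_taus_nonempty\<close> and \<open>error_bound_nonneg\<close> are needed.
\<close>

text \<open>The symbols \<open>\<bullet>\<close> and \<open>$\<close> denote operations on vectors of variable length throughout.\<close>

unbundle no inner_syntax and no vec_syntax

section \<open>Matrix arithmetic\<close>

lemma smult_mat_mult_vec:
  fixes A :: "'a :: comm_semiring_0 mat"
  shows "A \<in> carrier_mat m n \<Longrightarrow> v \<in> carrier_vec n \<Longrightarrow>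
    (c \<cdot>\<^sub>m A) *\<^sub>v v = c \<cdot>\<^sub>v (A *\<^sub>v v)"
  by (intro eq_vecI) (auto simp: scalar_prod_def sum_distrib_left mult.assoc)

lemma transpose_smult_mat: "transpose_mat (c \<cdot>\<^sub>m A) = c \<cdot>\<^sub>m transpose_mat A"
  by (intro eq_matI) auto

text \<open>Associativity and transposition with side conditions on dimensions instead of carriers are
  conditional rewrite rules whose premises have no unknowns beyond those of the left-hand side.\<close>

lemma mat_mult_assoc_dim:
  fixes A B C :: "'a :: semiring_0 mat"
  assumes "dim_col A = dim_row B" "dim_col B = dim_row C"
  shows "A * B * C = A * (B * C)"
  by (rule assoc_mult_mat[OF carrier_matI[OF refl refl] carrier_matI[OF assms(1)[symmetric] refl]
        carrier_matI[OF assms(2)[symmetric] refl]])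

lemma mat_mult_vec_assoc_dim:
  fixes A B :: "'a :: semiring_0 mat"
  assumes "dim_col A = dim_row B" "dim_vec v = dim_col B"
  shows "A * B *\<^sub>v v = A *\<^sub>v (B *\<^sub>v v)"
  by (rule assoc_mult_mat_vec[OF carrier_matI[OF refl refl] carrier_matI[OF assms(1)[symmetric] refl]
        carrier_vecI[OF assms(2)]])

lemma transpose_mult_dim:
  fixes A B :: "'a :: comm_semiring_0 mat"
  assumes "dim_col A = dim_row B"
  shows "transpose_mat (A * B) = transpose_mat B * transpose_mat A"
  by (rule transpose_mult[OF carrier_matI[OF refl refl] carrier_matI[OF assms[symmetric] refl]])

section \<open>Euclidean norm and matrix 2-norm\<close>

lemma euclid_norm_eq_L2_set: "euclid_norm v = L2_set (($) v) {0..<dim_vec v}"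
  by (simp add: euclid_norm_def L2_set_def scalar_prod_def power2_eq_square)

lemma euclid_norm_nonneg [simp]: "0 \<le> euclid_norm v"
  by (simp add: euclid_norm_eq_L2_set)

lemma euclid_norm_square: "(euclid_norm v)\<^sup>2 = v \<bullet> v"
  by (simp add: euclid_norm_def scalar_prod_def sum_nonneg)

lemma scalar_prod_self_nonneg: "0 \<le> v \<bullet> (v :: real vec)"
  by (simp add: scalar_prod_def sum_nonneg)

lemma euclid_norm_zero_vec [simp]: "euclid_norm (0\<^sub>v n) = 0"
  by (simp add: euclid_norm_def)

lemma euclid_norm_smult: "euclid_norm (c \<cdot>\<^sub>v v) = \<bar>c\<bar> * euclid_norm v"
proof -
  have "(c \<cdot>\<^sub>v v) \<bullet> (c \<cdot>\<^sub>v v) = c\<^sup>2 * (v \<bullet> v)"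
    by (simp add: power2_eq_square)
  then show ?thesis
    by (simp add: euclid_norm_def real_sqrt_mult)
qed

lemma euclid_norm_triangle:
  assumes "v \<in> carrier_vec n" "w \<in> carrier_vec n"
  shows "euclid_norm (v + w) \<le> euclid_norm v + euclid_norm w"
proof -
  have "L2_set (($) (v + w)) {0..<n} = L2_set (\<lambda>i. v $ i + w $ i) {0..<n}"
    using assms by (intro L2_set_cong) auto
  then show ?thesis
    using assms L2_set_triangle_ineq[of "($) v" "($) w" "{0..<n}"]
    by (simp add: euclid_norm_eq_L2_set)
qed

lemma scalar_prod_le_euclid_norm:
  assumes "v \<in> carrier_vec n" "w \<in> carrier_vec n"
  shows "\<bar>v \<bullet> w\<bar> \<le> euclid_norm v * euclid_norm w"
proof -
  have "\<bar>v \<bullet> w\<bar> \<le> (\<Sum>i\<in>{0..<n}. \<bar>v $ i\<bar> * \<bar>w $ i\<bar>)"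
    using assms sum_abs[of "\<lambda>i. v $ i * w $ i" "{0..<n}"]
    by (simp add: scalar_prod_def abs_mult)
  also have "\<dots> \<le> euclid_norm v * euclid_norm w"
    using assms L2_set_mult_ineq[of "($) v" "($) w" "{0..<n}"]
    by (simp add: euclid_norm_eq_L2_set)
  finally show ?thesis .
qed

lemma mult_mat_vec_bounded:
  assumes A: "A \<in> carrier_mat m n"
  obtains C where "0 < C" "\<And>v. v \<in> carrier_vec n \<Longrightarrow> euclid_norm (A *\<^sub>v v) \<le> C * euclid_norm v"
proof -
  define C where "C = (\<Sum>i<m. euclid_norm (row A i)) + 1"
  have "euclid_norm (A *\<^sub>v v) \<le> C * euclid_norm v" if v: "v \<in> carrier_vec n" for v
  proof -
    have "euclid_norm (A *\<^sub>v v) \<le> (\<Sum>i<m. \<bar>(A *\<^sub>v v) $ i\<bar>)"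
      using A L2_set_le_sum_abs[of "($) (A *\<^sub>v v)" "{0..<m}"]
      by (simp add: euclid_norm_eq_L2_set atLeast0LessThan)
    also have "\<dots> \<le> (\<Sum>i<m. euclid_norm (row A i) * euclid_norm v)"
      using A v by (intro sum_mono) (auto intro!: scalar_prod_le_euclid_norm[of _ n])
    also have "\<dots> \<le> C * euclid_norm v"
      by (simp add: C_def sum_distrib_right distrib_right)
    finally show ?thesis .
  qed
  moreover have "0 < C"
    unfolding C_def by (intro add_nonneg_pos sum_nonneg) auto
  ultimately show ?thesis
    using that by blast
qed

lemma norm2_le:
  assumes A: "A \<in> carrier_mat m n" and "0 \<le> c"
    and bound: "\<And>v. v \<in> carrier_vec n \<Longrightarrow> euclid_norm (A *\<^sub>v v) \<le> c * euclid_norm v"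
  shows "norm2 A \<le> c"
  unfolding norm2_def
proof (rule cSUP_least)
  show "{v \<in> carrier_vec (dim_col A). euclid_norm v \<le> 1} \<noteq> {}"
    by (auto intro!: exI[of _ "0\<^sub>v n"] simp: A[THEN carrier_matD(2)])
next
  fix v assume v: "v \<in> {v \<in> carrier_vec (dim_col A). euclid_norm v \<le> 1}"
  then have "c * euclid_norm v \<le> c"
    using \<open>0 \<le> c\<close> by (simp add: mult_left_le)
  then show "euclid_norm (A *\<^sub>v v) \<le> c"
    using bound[of v] v A by auto
qed

lemma bdd_above_unit_ball_image:
  "bdd_above ((\<lambda>v. euclid_norm (A *\<^sub>v v)) ` {v \<in> carrier_vec (dim_col A). euclid_norm v \<le> 1})"
proof -
  obtain C where C: "0 < C"
      "\<And>v. v \<in> carrier_vec (dim_col A) \<Longrightarrow> euclid_norm (A *\<^sub>v v) \<le> C * euclid_norm v"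
    using mult_mat_vec_bounded[of A "dim_row A" "dim_col A"] by blast
  show ?thesis
  proof (rule bdd_aboveI2[where M = C])
    fix w assume w: "w \<in> {v \<in> carrier_vec (dim_col A). euclid_norm v \<le> 1}"
    then have "C * euclid_norm w \<le> C"
      using C(1) by (simp add: mult_left_le)
    then show "euclid_norm (A *\<^sub>v w) \<le> C"
      using C(2)[of w] w by auto
  qed
qed

text \<open>A vector of positive norm is rescaled to the unit sphere; one of norm \<open>0\<close> is mapped to a
  vector of norm \<open>0\<close> because the matrix is bounded.\<close>

lemma euclid_norm_mult_mat_vec_le:
  assumes A: "A \<in> carrier_mat m n" and v: "v \<in> carrier_vec n"
  shows "euclid_norm (A *\<^sub>v v) \<le> norm2 A * euclid_norm v"
proof (cases "euclid_norm v = 0")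
  case True
  then show ?thesis
    using mult_mat_vec_bounded[OF A] v by (metis mult_zero_right)
next
  case False
  then have pos: "0 < euclid_norm v"
    by (simp add: less_le)
  define u where "u = (1 / euclid_norm v) \<cdot>\<^sub>v v"
  have u: "u \<in> {v \<in> carrier_vec (dim_col A). euclid_norm v \<le> 1}"
    using v A pos by (simp add: u_def euclid_norm_smult)
  have "euclid_norm (A *\<^sub>v u) \<le> norm2 A"
    unfolding norm2_def by (rule cSUP_upper[OF u bdd_above_unit_ball_image])
  moreover have "euclid_norm (A *\<^sub>v u) = euclid_norm (A *\<^sub>v v) / euclid_norm v"
    using A v pos by (simp add: u_def mult_mat_vec[OF A v] euclid_norm_smult)
  ultimately show ?thesis
    using pos by (simp add: divide_le_eq)
qed

lemma norm2_nonneg: "0 \<le> norm2 A"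
proof -
  have "euclid_norm (A *\<^sub>v 0\<^sub>v (dim_col A)) \<le> norm2 A"
    unfolding norm2_def by (rule cSUP_upper[OF _ bdd_above_unit_ball_image]) simp
  then show ?thesis
    using euclid_norm_nonneg order_trans by blast
qed

lemma norm2_add_le:
  assumes A: "A \<in> carrier_mat m n" and B: "B \<in> carrier_mat m n"
  shows "norm2 (A + B) \<le> norm2 A + norm2 B"
proof (rule norm2_le[of _ m n])
  fix v :: "real vec" assume v: "v \<in> carrier_vec n"
  have "euclid_norm ((A + B) *\<^sub>v v) \<le> euclid_norm (A *\<^sub>v v) + euclid_norm (B *\<^sub>v v)"
    unfolding add_mult_distrib_mat_vec[OF A B v]
    using A B v by (intro euclid_norm_triangle[of _ m]) auto
  also have "\<dots> \<le> norm2 A * euclid_norm v + norm2 B * euclid_norm v"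
    using euclid_norm_mult_mat_vec_le A B v by (intro add_mono)
  finally show "euclid_norm ((A + B) *\<^sub>v v) \<le> (norm2 A + norm2 B) * euclid_norm v"
    by (simp add: algebra_simps)
qed (use A B norm2_nonneg in auto)

lemma norm2_mult_le:
  assumes A: "A \<in> carrier_mat m n" and B: "B \<in> carrier_mat n p"
  shows "norm2 (A * B) \<le> norm2 A * norm2 B"
proof (rule norm2_le[of _ m p])
  fix v :: "real vec" assume v: "v \<in> carrier_vec p"
  have "euclid_norm ((A * B) *\<^sub>v v) \<le> norm2 A * euclid_norm (B *\<^sub>v v)"
    unfolding assoc_mult_mat_vec[OF A B v]
    using A B v by (intro euclid_norm_mult_mat_vec_le) auto
  also have "\<dots> \<le> norm2 A * (norm2 B * euclid_norm v)"
    using euclid_norm_mult_mat_vec_le[OF B v] norm2_nonneg by (intro mult_left_mono)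
  finally show "euclid_norm ((A * B) *\<^sub>v v) \<le> norm2 A * norm2 B * euclid_norm v"
    by (simp add: algebra_simps)
qed (use A B norm2_nonneg in auto)

text \<open>With \<open>x = A\<^sup>T y\<close>, \<open>\<bar>x\<bar>\<^sup>2 = y \<bullet> A x \<le> \<bar>y\<bar> c \<bar>x\<bar>\<close>, and one
  factor \<open>\<bar>x\<bar>\<close> cancels.\<close>

lemma transpose_bound:
  assumes A: "A \<in> carrier_mat m n" and "0 \<le> c"
    and bound: "\<And>v. v \<in> carrier_vec n \<Longrightarrow> euclid_norm (A *\<^sub>v v) \<le> c * euclid_norm v"
    and y: "y \<in> carrier_vec m"
  shows "euclid_norm (transpose_mat A *\<^sub>v y) \<le> c * euclid_norm y"
proof -
  define x where "x = transpose_mat A *\<^sub>v y"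
  have x: "x \<in> carrier_vec n"
    using A y by (simp add: x_def)
  have "(euclid_norm x)\<^sup>2 = y \<bullet> (A *\<^sub>v x)"
    using transpose_vec_mult_scalar[OF A x y] by (simp add: euclid_norm_square x_def)
  also have "\<dots> \<le> euclid_norm y * euclid_norm (A *\<^sub>v x)"
    using scalar_prod_le_euclid_norm[of y m "A *\<^sub>v x"] A x y by auto
  also have "\<dots> \<le> euclid_norm y * (c * euclid_norm x)"
    using bound[OF x] by (intro mult_left_mono) auto
  finally have "euclid_norm x * euclid_norm x \<le> (c * euclid_norm y) * euclid_norm x"
    by (simp add: power2_eq_square algebra_simps)
  then have "euclid_norm x \<le> c * euclid_norm y"
    using \<open>0 \<le> c\<close> by (cases "euclid_norm x = 0") (auto simp: mult_le_cancel_right less_le)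
  then show ?thesis
    by (simp add: x_def)
qed

lemma norm2_le_transpose:
  assumes A: "A \<in> carrier_mat m n" and "0 \<le> c"
    and "\<And>y. y \<in> carrier_vec m \<Longrightarrow> euclid_norm (transpose_mat A *\<^sub>v y) \<le> c * euclid_norm y"
  shows "norm2 A \<le> c"
  using transpose_bound[of "transpose_mat A" n m c] assms
  by (intro norm2_le[OF A]) auto

section \<open>The largest eigenvalue bounds the quadratic form\<close>

text \<open>
  Let \<open>\<mu>\<^sub>0\<close> be the least number
  with \<open>x \<bullet> M x \<le> \<mu>\<^sub>0 \<bar>x\<bar>\<^sup>2\<close> for all \<open>x\<close>; then \<open>N = \<mu>\<^sub>0 - M\<close> is positive semidefinite. If \<open>N\<close> had an
  inverse \<open>K\<close>, bounded by \<open>L\<close>, then \<open>N\<close> would even be bounded below by \<open>1 / L\<close>, and \<open>\<mu>\<^sub>0 - 1 / L\<close>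
  would still bound the form of \<open>M\<close>. So \<open>N\<close> is singular, and \<open>\<mu>\<^sub>0\<close> is an eigenvalue of \<open>M\<close>.
\<close>

lemma quadratic_form_le_lambda_max:
  assumes M: "M \<in> carrier_mat n n" and sym: "transpose_mat M = M"
    and x: "x \<in> carrier_vec n" and "0 < n"
  shows "x \<bullet> (M *\<^sub>v x) \<le> lambda_max M * (x \<bullet> x)"
proof -
  define G where "G = {\<mu>. \<forall>x \<in> carrier_vec n. x \<bullet> (M *\<^sub>v x) \<le> \<mu> * (x \<bullet> x)}"
  define \<mu>\<^sub>0 where "\<mu>\<^sub>0 = Inf G"
  obtain C where C: "0 < C"
      "\<And>v. v \<in> carrier_vec n \<Longrightarrow> euclid_norm (M *\<^sub>v v) \<le> C * euclid_norm v"
    using mult_mat_vec_bounded[OF M] by blast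
  have "C \<in> G"
    unfolding G_def
  proof safe
    fix v :: "real vec" assume v: "v \<in> carrier_vec n"
    have "v \<bullet> (M *\<^sub>v v) \<le> euclid_norm v * euclid_norm (M *\<^sub>v v)"
      using scalar_prod_le_euclid_norm[of v n "M *\<^sub>v v"] M v by auto
    also have "\<dots> \<le> euclid_norm v * (C * euclid_norm v)"
      using C(2)[OF v] by (intro mult_left_mono) auto
    finally show "v \<bullet> (M *\<^sub>v v) \<le> C * (v \<bullet> v)"
      by (simp add: euclid_norm_square[symmetric] power2_eq_square algebra_simps)
  qed
  have bdd: "bdd_below G"
  proof (rule bdd_belowI)
    fix \<mu> assume "\<mu> \<in> G"
    then show "unit_vec n 0 \<bullet> (M *\<^sub>v unit_vec n 0) \<le> \<mu>"
      using \<open>0 < n\<close> by (auto simp: G_def dest!: bspec[of _ _ "unit_vec n 0"])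
  qed
  have form_le: "v \<bullet> (M *\<^sub>v v) \<le> \<mu>\<^sub>0 * (v \<bullet> v)" if v: "v \<in> carrier_vec n" for v
  proof (cases "v \<bullet> v = 0")
    case True
    then show ?thesis using \<open>C \<in> G\<close> v unfolding G_def by fastforce
  next
    case False
    then have pos: "0 < v \<bullet> v"
      using scalar_prod_self_nonneg[of v] by simp
    have "v \<bullet> (M *\<^sub>v v) / (v \<bullet> v) \<le> \<mu>\<^sub>0"
      unfolding \<mu>\<^sub>0_def
      using \<open>C \<in> G\<close> v pos by (intro cInf_greatest) (auto simp: G_def divide_le_eq)
    then show ?thesis
      using pos by (simp add: divide_le_eq)
  qed
  define N where "N = \<mu>\<^sub>0 \<cdot>\<^sub>m 1\<^sub>m n - M"
  have N: "N \<in> carrier_mat n n"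
    using M by (simp add: N_def minus_carrier_mat)
  have N_vec: "N *\<^sub>v v = \<mu>\<^sub>0 \<cdot>\<^sub>v v - M *\<^sub>v v" if v: "v \<in> carrier_vec n" for v
    using minus_mult_distrib_mat_vec[of "\<mu>\<^sub>0 \<cdot>\<^sub>m 1\<^sub>m n" n n M v] M v
    by (simp add: N_def smult_mat_mult_vec[of _ n n])
  have N_form: "v \<bullet> (N *\<^sub>v v) = \<mu>\<^sub>0 * (v \<bullet> v) - v \<bullet> (M *\<^sub>v v)" if v: "v \<in> carrier_vec n" for v
    using scalar_prod_minus_distrib[of v n "\<mu>\<^sub>0 \<cdot>\<^sub>v v" "M *\<^sub>v v"] v M by (simp add: N_vec)
  have "transpose_mat N = N"
    using sym M transpose_minus[of "\<mu>\<^sub>0 \<cdot>\<^sub>m 1\<^sub>m n" n n M] by (simp add: N_def transpose_smult_mat)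
  have "det N = 0"
  proof (rule ccontr)
    assume "det N \<noteq> 0"
    then obtain K where K: "K \<in> carrier_mat n n" and NK: "N * K = 1\<^sub>m n"
      using det_non_zero_imp_unit[OF N, of undefined]
      by (auto simp: Units_def ring_mat_simps)
    obtain L where L: "0 < L"
        "\<And>v. v \<in> carrier_vec n \<Longrightarrow> euclid_norm (K *\<^sub>v v) \<le> L * euclid_norm v"
      using mult_mat_vec_bounded[OF K] by blast
    have "\<mu>\<^sub>0 - 1 / L \<in> G"
      unfolding G_def
    proof safe
      fix v :: "real vec" assume v: "v \<in> carrier_vec n"
      define y where "y = K *\<^sub>v v"
      define t where "t = 1 / L"
      have y: "y \<in> carrier_vec n" and Ny: "N *\<^sub>v y = v"
        using K v NK N assoc_mult_mat_vec[OF N K v] by (auto simp: y_def)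
      have Nv: "N *\<^sub>v v \<in> carrier_vec n"
        using N v by simp
      have yNv: "y \<bullet> (N *\<^sub>v v) = v \<bullet> v"
        using transpose_vec_mult_scalar[OF N v y] \<open>transpose_mat N = N\<close> Ny by simp
      have "y \<bullet> v \<le> euclid_norm y * euclid_norm v"
        using scalar_prod_le_euclid_norm[OF y v] by simp
      also have "\<dots> \<le> L * euclid_norm v * euclid_norm v"
        using L(2)[OF v] by (intro mult_right_mono) (auto simp: y_def)
      finally have yv: "y \<bullet> v \<le> L * (v \<bullet> v)"
        by (simp add: euclid_norm_square[symmetric] power2_eq_square algebra_simps)
      \<comment> \<open>The form of \<open>N\<close> at \<open>v - t y\<close> is \<open>v \<bullet> N v - 2 t \<bar>v\<bar>\<^sup>2 + t\<^sup>2 (y \<bullet> v)\<close>; \<open>t = 1 / L\<close>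
        optimizes the resulting lower bound on \<open>v \<bullet> N v\<close>.\<close>
      have "0 \<le> (v - t \<cdot>\<^sub>v y) \<bullet> (N *\<^sub>v (v - t \<cdot>\<^sub>v y))"
        using form_le[of "v - t \<cdot>\<^sub>v y"] N_form[of "v - t \<cdot>\<^sub>v y"] v y by simp
      also have "N *\<^sub>v (v - t \<cdot>\<^sub>v y) = N *\<^sub>v v - t \<cdot>\<^sub>v v"
        using mult_minus_distrib_mat_vec[OF N v, of "t \<cdot>\<^sub>v y"] mult_mat_vec[OF N y] Ny y by simp
      also have "(v - t \<cdot>\<^sub>v y) \<bullet> (N *\<^sub>v v - t \<cdot>\<^sub>v v) =
          v \<bullet> (N *\<^sub>v v) - 2 * t * (v \<bullet> v) + t * t * (y \<bullet> v)"
        using v y Nv yNv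
        by (simp add: minus_scalar_prod_distrib[of _ n] scalar_prod_minus_distrib[of _ n]
            algebra_simps)
      also have "\<dots> \<le> v \<bullet> (N *\<^sub>v v) - 2 * t * (v \<bullet> v) + t * t * (L * (v \<bullet> v))"
        using yv by (intro add_left_mono mult_left_mono) auto
      also have "\<dots> = v \<bullet> (N *\<^sub>v v) - t * (v \<bullet> v)"
        using L(1) by (simp add: t_def)
      finally show "v \<bullet> (M *\<^sub>v v) \<le> (\<mu>\<^sub>0 - 1 / L) * (v \<bullet> v)"
        using N_form[OF v] by (simp add: t_def algebra_simps)
    qed
    then have "\<mu>\<^sub>0 \<le> \<mu>\<^sub>0 - 1 / L"
      unfolding \<mu>\<^sub>0_def using bdd by (intro cInf_lower)
    then show False using L(1) by simp
  qed
  then obtain v where v: "v \<in> carrier_vec n" "v \<noteq> 0\<^sub>v n" and Nv: "N *\<^sub>v v = 0\<^sub>v n"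
    using det_0_iff_vec_prod_zero_field[OF N] by auto
  have "M *\<^sub>v v = \<mu>\<^sub>0 \<cdot>\<^sub>v v"
  proof (rule eq_vecI)
    fix i assume "i < dim_vec (\<mu>\<^sub>0 \<cdot>\<^sub>v v)"
    then have i: "i < n" using v by simp
    then have "(\<mu>\<^sub>0 \<cdot>\<^sub>v v - M *\<^sub>v v) $ i = 0"
      using Nv N_vec[OF v(1)] by simp
    then show "(M *\<^sub>v v) $ i = (\<mu>\<^sub>0 \<cdot>\<^sub>v v) $ i"
      using i v M by simp
  qed (use M v in simp)
  then have "eigenvalue M \<mu>\<^sub>0"
    using v M by (auto simp: eigenvalue_def eigenvector_def)
  moreover have "finite {e. eigenvalue M e}"
  proof -
    have "char_poly M \<noteq> 0"
      using degree_monic_char_poly[OF M] by auto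
    then show ?thesis
      using poly_roots_finite by (simp add: eigenvalue_root_char_poly[OF M])
  qed
  ultimately have "\<mu>\<^sub>0 \<le> lambda_max M"
    unfolding lambda_max_def by (intro Max_ge) auto
  then show ?thesis
    using form_le[OF x] mult_right_mono[OF _ scalar_prod_self_nonneg] order_trans by blast
qed

text \<open>The quadratic form of \<open>A\<^sub>f A\<^sub>f\<^sup>T - \<tau> A\<^sub>c A\<^sub>c\<^sup>T\<close> at \<open>x\<close> is \<open>\<bar>A\<^sub>f\<^sup>T x\<bar>\<^sup>2 - \<tau> \<bar>A\<^sub>c\<^sup>T x\<bar>\<^sup>2\<close>.\<close>

lemma eps_bound:
  assumes Af: "Af \<in> carrier_mat m n" and Ac: "Ac \<in> carrier_mat m nc"
    and x: "x \<in> carrier_vec m" and "0 < m"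
  shows "(euclid_norm (transpose_mat Af *\<^sub>v x))\<^sup>2 \<le>
    eps Af Ac \<tau> * (euclid_norm x)\<^sup>2 + \<tau> * (euclid_norm (transpose_mat Ac *\<^sub>v x))\<^sup>2"
proof -
  have gram: "x \<bullet> ((A * transpose_mat A) *\<^sub>v x) = (euclid_norm (transpose_mat A *\<^sub>v x))\<^sup>2"
    if A: "A \<in> carrier_mat m q" for A q
  proof -
    have tx: "transpose_mat A *\<^sub>v x \<in> carrier_vec q"
      using A x by simp
    have "(A * transpose_mat A) *\<^sub>v x = A *\<^sub>v (transpose_mat A *\<^sub>v x)"
      using A x by (intro assoc_mult_mat_vec) auto
    then show ?thesis
      using transpose_vec_mult_scalar[OF A tx x] by (simp add: euclid_norm_square)
  qed
  define M where "M = Af * transpose_mat Af - \<tau> \<cdot>\<^sub>m (Ac * transpose_mat Ac)"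
  have M: "M \<in> carrier_mat m m"
    using Af Ac by (simp add: M_def minus_carrier_mat)
  have sym: "transpose_mat M = M"
    using Af Ac transpose_mult[of Af m n "transpose_mat Af" m]
      transpose_mult[of Ac m nc "transpose_mat Ac" m]
      transpose_minus[of "Af * transpose_mat Af" m m "\<tau> \<cdot>\<^sub>m (Ac * transpose_mat Ac)"]
    by (simp add: M_def transpose_smult_mat)
  have Mx: "M *\<^sub>v x = (Af * transpose_mat Af) *\<^sub>v x - \<tau> \<cdot>\<^sub>v ((Ac * transpose_mat Ac) *\<^sub>v x)"
    using minus_mult_distrib_mat_vec[of "Af * transpose_mat Af" m m
        "\<tau> \<cdot>\<^sub>m (Ac * transpose_mat Ac)" x] Af Ac x
      smult_mat_mult_vec[of "Ac * transpose_mat Ac" m m x \<tau>]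
    by (simp add: M_def del: assoc_mult_mat_vec)
  have "x \<bullet> (M *\<^sub>v x) = x \<bullet> ((Af * transpose_mat Af) *\<^sub>v x) -
      \<tau> * (x \<bullet> ((Ac * transpose_mat Ac) *\<^sub>v x))"
  proof -
    have c: "(Af * transpose_mat Af) *\<^sub>v x \<in> carrier_vec m"
        "(Ac * transpose_mat Ac) *\<^sub>v x \<in> carrier_vec m"
      using Af Ac x by (intro mult_mat_vec_carrier[of _ m m] mult_carrier_mat[of _ m]; simp)+
    have d: "\<tau> \<cdot>\<^sub>v ((Ac * transpose_mat Ac) *\<^sub>v x) \<in> carrier_vec m"
      using c(2) by (rule smult_carrier_vec[THEN iffD2])
    show ?thesis
      unfolding Mx scalar_prod_minus_distrib[OF x c(1) d] scalar_prod_smult_distrib[OF x c(2)] ..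
  qed
  then show ?thesis
    using quadratic_form_le_lambda_max[OF M sym x \<open>0 < m\<close>] gram[OF Af] gram[OF Ac]
    by (simp add: eps_def M_def euclid_norm_square)
qed

text \<open>A column \<open>x \<noteq> 0\<close> of \<open>A\<^sub>f\<close> satisfies \<open>A\<^sub>f\<^sup>T x \<noteq> 0\<close>, so for small \<open>\<tau> > 0\<close> the quadratic form of
  \<open>A\<^sub>f A\<^sub>f\<^sup>T - \<tau> A\<^sub>c A\<^sub>c\<^sup>T\<close> is nonnegative at \<open>x\<close>, and with it the largest eigenvalue.\<close>

lemma admissible_taus_nonempty:
  assumes Af: "Af \<in> carrier_mat m n" and Ac: "Ac \<in> carrier_mat m nc"
    and "0 < m" and nz: "Af \<noteq> 0\<^sub>m m n"
  shows "admissible_taus Af Ac \<noteq> {}"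
proof -
  obtain i j where ij: "i < m" "j < n" "Af $$ (i, j) \<noteq> 0"
    using nz Af by (metis carrier_matD eq_matI index_zero_mat)
  define x where "x = col Af j"
  have x: "x \<in> carrier_vec m" and xi: "x $ i \<noteq> 0"
    using Af ij by (auto simp: x_def)
  have "0 < x \<bullet> x"
  proof -
    have "0 < (x $ i)\<^sup>2" using xi by simp
    also have "\<dots> \<le> (\<Sum>l\<in>{0..<m}. (x $ l)\<^sup>2)"
      using ij by (intro member_le_sum) auto
    also have "\<dots> = x \<bullet> x"
      using x by (simp add: scalar_prod_def power2_eq_square)
    finally show ?thesis .
  qed
  moreover have "(transpose_mat Af *\<^sub>v x) $ j = x \<bullet> x"
    using Af ij by (simp add: x_def)
  ultimately have "(transpose_mat Af *\<^sub>v x) $ j \<noteq> 0"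
    by simp
  define a where "a = (euclid_norm (transpose_mat Af *\<^sub>v x))\<^sup>2"
  define b where "b = (euclid_norm (transpose_mat Ac *\<^sub>v x))\<^sup>2"
  \<comment> \<open>The summand \<open>1\<close> covers the case \<open>b = 0\<close>.\<close>
  define \<tau> where "\<tau> = a / (b + 1)"
  have "0 < ((transpose_mat Af *\<^sub>v x) $ j)\<^sup>2"
    using \<open>(transpose_mat Af *\<^sub>v x) $ j \<noteq> 0\<close> by simp
  also have "\<dots> \<le> (\<Sum>l\<in>{0..<n}. ((transpose_mat Af *\<^sub>v x) $ l)\<^sup>2)"
    using ij by (intro member_le_sum) auto
  also have "\<dots> = a"
    using Af unfolding a_def euclid_norm_square scalar_prod_def by (simp add: power2_eq_square)
  finally have "0 < a" .
  have "0 \<le> b" by (simp add: b_def)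
  have "0 < \<tau>"
    using \<open>0 < a\<close> \<open>0 \<le> b\<close> by (simp add: \<tau>_def)
  moreover have "\<tau> * b \<le> a"
    using \<open>0 < a\<close> \<open>0 \<le> b\<close> by (simp add: \<tau>_def field_simps)
  then have "0 \<le> eps Af Ac \<tau> * (x \<bullet> x)"
    using eps_bound[OF Af Ac x \<open>0 < m\<close>, of \<tau>]
    by (simp add: a_def b_def euclid_norm_square)
  then have "0 \<le> eps Af Ac \<tau>"
    using \<open>0 < x \<bullet> x\<close> by (simp add: zero_le_mult_iff)
  ultimately show ?thesis
    by (auto simp: admissible_taus_def)
qed

section \<open>Diagonal matrices and pseudoinverses\<close>

definition diag_of :: "nat \<Rightarrow> (nat \<Rightarrow> real) \<Rightarrow> real mat" where
  "diag_of p f = mat p p (\<lambda>(i, j). if i = j then f i else 0)"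

lemma diag_of_carrier [simp]: "diag_of p f \<in> carrier_mat p p"
  by (simp add: diag_of_def)

lemma dim_diag_of [simp]: "dim_row (diag_of p f) = p" "dim_col (diag_of p f) = p"
  by (simp_all add: diag_of_def)

lemma transpose_diag_of [simp]: "transpose_mat (diag_of p f) = diag_of p f"
  by (auto simp: diag_of_def)

lemma diag_of_cong: "(\<And>i. i < p \<Longrightarrow> f i = g i) \<Longrightarrow> diag_of p f = diag_of p g"
  by (auto simp: diag_of_def)

lemma diag_of_mult_index:
  assumes "A \<in> carrier_mat p q" "i < p" "j < q"
  shows "(diag_of p f * A) $$ (i, j) = f i * A $$ (i, j)"
proof -
  have "(diag_of p f * A) $$ (i, j) = (\<Sum>l\<in>{0..<p}. (if i = l then f i else 0) * A $$ (l, j))"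
    using assms by (simp add: diag_of_def scalar_prod_def)
  also have "\<dots> = (\<Sum>l\<in>{0..<p}. if i = l then f i * A $$ (l, j) else 0)"
    by (intro sum.cong) auto
  finally show ?thesis
    using assms by simp
qed

lemma diag_of_mult [simp]: "diag_of p f * diag_of p g = diag_of p (\<lambda>i. f i * g i)"
proof (rule eq_matI)
  fix i j assume "i < dim_row (diag_of p (\<lambda>i. f i * g i))" "j < dim_col (diag_of p (\<lambda>i. f i * g i))"
  then have ij: "i < p" "j < p" by auto
  show "(diag_of p f * diag_of p g) $$ (i, j) = diag_of p (\<lambda>i. f i * g i) $$ (i, j)"
    unfolding diag_of_mult_index[OF diag_of_carrier ij] using ij by (simp add: diag_of_def)
qed auto

lemma diag_of_mult_vec_index:
  assumes "v \<in> carrier_vec p" "i < p"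
  shows "(diag_of p f *\<^sub>v v) $ i = f i * v $ i"
proof -
  have "(diag_of p f *\<^sub>v v) $ i = (\<Sum>l\<in>{0..<p}. (if i = l then f i else 0) * v $ l)"
    using assms by (simp add: diag_of_def scalar_prod_def)
  also have "\<dots> = (\<Sum>l\<in>{0..<p}. if i = l then f i * v $ l else 0)"
    by (intro sum.cong) auto
  finally show ?thesis
    using assms by simp
qed

lemma euclid_norm_diag_of_le:
  assumes v: "v \<in> carrier_vec p" and f: "\<And>i. i < p \<Longrightarrow> \<bar>f i\<bar> \<le> c" and "0 \<le> c"
  shows "euclid_norm (diag_of p f *\<^sub>v v) \<le> c * euclid_norm v"
proof -
  have "L2_set (($) (diag_of p f *\<^sub>v v)) {0..<p} = L2_set (\<lambda>i. \<bar>f i\<bar> * \<bar>v $ i\<bar>) {0..<p}"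
    unfolding L2_set_def using v
    by (simp add: diag_of_mult_vec_index power_mult_distrib del: index_mult_mat_vec)
  also have "\<dots> \<le> L2_set (\<lambda>i. c * \<bar>v $ i\<bar>) {0..<p}"
    using f by (intro L2_set_mono mult_right_mono) auto
  also have "\<dots> = c * L2_set (\<lambda>i. \<bar>v $ i\<bar>) {0..<p}"
    using \<open>0 \<le> c\<close> by (simp add: L2_set_right_distrib)
  also have "L2_set (\<lambda>i. \<bar>v $ i\<bar>) {0..<p} = L2_set (($) v) {0..<p}"
    by (simp add: L2_set_def)
  finally show ?thesis
    using v by (simp add: euclid_norm_eq_L2_set)
qed

lemma diagonal_mat_eq_diag_of:
  assumes "S \<in> carrier_mat p p" "diagonal_mat S"
  shows "S = diag_of p (\<lambda>i. S $$ (i, i))"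
  using assms by (intro eq_matI) (auto simp: diag_of_def diagonal_mat_def)

text \<open>\<open>A X\<close> and \<open>A Y\<close> are both the orthogonal projection onto the range of \<open>A\<close>, so they agree, and
  likewise \<open>X A = Y A\<close>; then \<open>X = X A X = Y A X = Y A Y = Y\<close>.\<close>

lemma is_pinv_unique:
  assumes X: "is_pinv A X" and Y: "is_pinv A Y"
  shows "X = Y"
proof -
  define m n where "m = dim_row A" and "n = dim_col A"
  have A: "A \<in> carrier_mat m n" by (simp add: m_def n_def)
  have Xc: "X \<in> carrier_mat n m" and Yc: "Y \<in> carrier_mat n m"
    using X Y by (auto simp: is_pinv_def m_def n_def)
  note c = A Xc Yc
  have AXA: "A * X * A = A" and XAX: "X * A * X = X"
    and AXt: "transpose_mat (A * X) = A * X" and XAt: "transpose_mat (X * A) = X * A"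
    using X by (auto simp: is_pinv_def)
  have AYA: "A * Y * A = A" and YAY: "Y * A * Y = Y"
    and AYt: "transpose_mat (A * Y) = A * Y" and YAt: "transpose_mat (Y * A) = Y * A"
    using Y by (auto simp: is_pinv_def)
  have AX_AY: "A * X = A * Y"
  proof -
    have "A * X = transpose_mat (A * Y * A * X)"
      using AXt AYA by simp
    also have "A * Y * A * X = (A * Y) * (A * X)"
      using c by (intro assoc_mult_mat[of _ m m _ n]) auto
    also have "transpose_mat \<dots> = (A * X) * (A * Y)"
      using c transpose_mult[of "A * Y" m m "A * X" m] AXt AYt by simp
    also have "\<dots> = A * X * A * Y"
      using c by (intro assoc_mult_mat[symmetric, of _ m m _ n]) auto
    finally show ?thesis using AXA by simp
  qed
  have XA_YA: "X * A = Y * A"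
  proof -
    have "X * A = (X * A) * (Y * A)"
    proof -
      have "(X * A) * (Y * A) = X * (A * (Y * A))"
        using c by (intro assoc_mult_mat[of _ n m _ n]) auto
      also have "A * (Y * A) = A"
        using c AYA assoc_mult_mat[of A m n Y m A n] by simp
      finally show ?thesis by simp
    qed
    then have "X * A = transpose_mat ((X * A) * (Y * A))"
      using XAt by simp
    also have "\<dots> = (Y * A) * (X * A)"
      using c transpose_mult[of "X * A" n n "Y * A" n] XAt YAt by simp
    also have "\<dots> = Y * (A * (X * A))"
      using c by (intro assoc_mult_mat[of _ n m _ n]) auto
    also have "A * (X * A) = A"
      using c AXA assoc_mult_mat[of A m n X m A n] by simp
    finally show ?thesis .
  qed
  have "X = X * A * X" using XAX by simp
  also have "\<dots> = Y * (A * X)"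
    unfolding XA_YA using c by (intro assoc_mult_mat[of _ n m _ n]) auto
  also have "\<dots> = Y * A * Y"
    unfolding AX_AY using c by (intro assoc_mult_mat[symmetric, of _ n m _ n]) auto
  finally show ?thesis using YAY by simp
qed

text \<open>Zero entries are covered by \<open>inverse 0 = 0\<close>.\<close>

lemma pinv_diag_of: "pinv (diag_of p f) = diag_of p (\<lambda>i. inverse (f i))"
proof -
  have inv: "a * inverse a * a = a" "inverse a * a * inverse a = inverse a" for a :: real
    by (cases "a = 0"; simp)+
  have "is_pinv (diag_of p f) (diag_of p (\<lambda>i. inverse (f i)))"
    by (simp add: is_pinv_def inv)
  then show ?thesis
    unfolding pinv_def using is_pinv_unique by blast
qed

section \<open>Matrices with orthonormal columns\<close>

lemma orthonormal_transpose_mult_vec: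
  fixes U :: "real mat"
  assumes U: "U \<in> carrier_mat m p" and orth: "transpose_mat U * U = 1\<^sub>m p"
    and v: "v \<in> carrier_vec p"
  shows "transpose_mat U *\<^sub>v (U *\<^sub>v v) = v"
proof -
  have "transpose_mat U *\<^sub>v (U *\<^sub>v v) = transpose_mat U * U *\<^sub>v v"
    using U v by (intro assoc_mult_mat_vec[symmetric]) auto
  then show ?thesis
    unfolding orth using one_mult_mat_vec[OF v] by simp
qed

lemma euclid_norm_orthonormal:
  assumes U: "U \<in> carrier_mat m p" and orth: "transpose_mat U * U = 1\<^sub>m p"
    and v: "v \<in> carrier_vec p"
  shows "euclid_norm (U *\<^sub>v v) = euclid_norm v"
proof -
  have "(U *\<^sub>v v) \<bullet> (U *\<^sub>v v) = v \<bullet> v"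
    using transpose_vec_mult_scalar[OF U v, of "U *\<^sub>v v"] U v
      orthonormal_transpose_mult_vec[OF assms] by simp
  then show ?thesis
    by (simp add: euclid_norm_def)
qed

text \<open>Bessel's inequality.\<close>

lemma euclid_norm_orthonormal_transpose_le:
  assumes U: "U \<in> carrier_mat m p" and orth: "transpose_mat U * U = 1\<^sub>m p"
    and y: "y \<in> carrier_vec m"
  shows "euclid_norm (transpose_mat U *\<^sub>v y) \<le> euclid_norm y"
  using transpose_bound[OF U, of 1 y] euclid_norm_orthonormal[OF U orth] y by simp

section \<open>Rank\<close>

context vec_space
begin

lemma mult_mat_vec_in_span_cols:
  assumes A: "A \<in> carrier_mat n q" and v: "v \<in> carrier_vec q"
  shows "A *\<^sub>v v \<in> span (set (cols A))"
proof -
  have "mat_of_cols n (cols A) *\<^sub>v vec (length (cols A)) (($) v) = lincomb_list (($) v) (cols A)"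
    using A cols_dim[of A] by (intro lincomb_list_as_mat_mult[symmetric]) auto
  moreover have "mat_of_cols n (cols A) = A" and "vec (length (cols A)) (($) v) = v"
    using A v by auto
  ultimately have "A *\<^sub>v v \<in> span_list (cols A)"
    by (auto intro: in_span_listI)
  then show ?thesis
    using A cols_dim[of A] by (simp add: span_list_as_span)
qed

lemma rank_mult_le:
  assumes A: "A \<in> carrier_mat n q" and B: "B \<in> carrier_mat q nc"
  shows "rank (A * B) \<le> q"
proof -
  have AB: "A * B \<in> carrier_mat n nc" using A B by simp
  have colsA: "set (cols A) \<subseteq> carrier_vec n" and colsAB: "set (cols (A * B)) \<subseteq> carrier_vec n"
    using A AB cols_dim by (metis carrier_matD(1))+
  have sub: "set (cols (A * B)) \<subseteq> span (set (cols A))"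
  proof
    fix x assume "x \<in> set (cols (A * B))"
    then obtain j where j: "j < nc" "x = col (A * B) j"
      using AB by (metis carrier_matD(2) cols_length cols_nth in_set_conv_nth)
    then have "x = A *\<^sub>v col B j"
      using col_mult2[OF A B] by simp
    then show "x \<in> span (set (cols A))"
      using mult_mat_vec_in_span_cols[OF A, of "col B j"] B j by simp
  qed
  have 1: "subspace class_ring (span (set (cols A))) V"
    and 2: "subspace class_ring (span (set (cols (A * B)))) V"
    using colsA colsAB span_is_subspace by auto
  have "span (set (cols (A * B))) \<subseteq> span (set (cols A))"
    using sub 1 span_is_subset by (simp add: subspace_def)
  from nested_subspaces[OF 1 2 this]
  have "rank (A * B) \<le> rank A"
    unfolding rank_def
    using vectorspace.subspace_dim[OF subspace_is_vs[OF 1]] fin_dim_span_cols[OF A]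
      fin_dim_span_cols[OF AB] by auto
  then show ?thesis
    using rank_le_nc[OF A] by simp
qed

end


lemma is_svdD:
  assumes "is_svd A U S V" and A: "A \<in> carrier_mat m n" and p: "p = min m n"
  shows "U \<in> carrier_mat m p" and "S \<in> carrier_mat p p" and "V \<in> carrier_mat n p"
    and "transpose_mat U * U = 1\<^sub>m p" and "transpose_mat V * V = 1\<^sub>m p"
    and "diagonal_mat S" and "\<And>i. i < p \<Longrightarrow> 0 \<le> S $$ (i, i)"
    and "\<And>i j. i \<le> j \<Longrightarrow> j < p \<Longrightarrow> S $$ (j, j) \<le> S $$ (i, i)"
    and "A = U * S * transpose_mat V"
  using assms(1) unfolding is_svd_def Let_def carrier_matD[OF A] p[symmetric] by blast+

text \<open>The remaining singular values vanish as well, so \<open>A\<close> is a product of a matrix with \<open>q\<close> columns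
  and a matrix with \<open>q\<close> rows. Contrapositively, \<open>\<sigma>\<^sub>r > 0\<close> for \<open>1 \<le> r \<le> rank A\<close>.\<close>

lemma rank_le_of_sing_val_zero:
  assumes svd: "is_svd A U S V" and zero: "sing_val S (q + 1) = 0"
  shows "vec_space.rank (dim_row A) A \<le> q"
proof -
  define m n p where "m = dim_row A" and "n = dim_col A" and "p = min m n"
  have U: "U \<in> carrier_mat m p" and S: "S \<in> carrier_mat p p" and V: "V \<in> carrier_mat n p"
    and diag: "diagonal_mat S" and A_eq: "A = U * S * transpose_mat V"
    and nonneg: "\<And>i. i < p \<Longrightarrow> 0 \<le> S $$ (i, i)"
    and dec: "\<And>i j. i \<le> j \<Longrightarrow> j < p \<Longrightarrow> S $$ (j, j) \<le> S $$ (i, i)"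
    using is_svdD[OF svd carrier_matI[OF m_def[symmetric] n_def[symmetric]] p_def] by blast+
  define B where "B = S * transpose_mat V"
  have B: "B \<in> carrier_mat p n"
    using S V by (simp add: B_def)
  have A_UB: "A = U * B"
    using U S V by (simp add: A_eq B_def mat_mult_assoc_dim)
  show ?thesis
  proof (cases "p \<le> q")
    case True
    then show ?thesis
      using vec_space.rank_mult_le[OF U B] A_UB by (simp add: m_def)
  next
    case False
    then have "S $$ (q, q) = 0"
      using zero S by (simp add: sing_val_def)
    then have Sz: "S $$ (i, i) = 0" if "q \<le> i" "i < p" for i
      using dec[of q i] nonneg[of i] that by simp
    have Bz: "B $$ (i, j) = 0" if "q \<le> i" "i < p" "j < n" for i j
    proof -
      have "B = diag_of p (\<lambda>i. S $$ (i, i)) * transpose_mat V"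
        unfolding B_def by (subst diagonal_mat_eq_diag_of[OF S diag]) simp
      then show ?thesis
        using V that Sz diag_of_mult_index[of "transpose_mat V" p n i j] by simp
    qed
    define U' where "U' = mat m q (\<lambda>(i, l). U $$ (i, l))"
    define B' where "B' = mat q n (\<lambda>(l, j). B $$ (l, j))"
    have "A = U' * B'"
    proof (rule eq_matI)
      fix i j assume "i < dim_row (U' * B')" "j < dim_col (U' * B')"
      then have ij: "i < m" "j < n" by (auto simp: U'_def B'_def)
      have "(U * B) $$ (i, j) = (\<Sum>l\<in>{0..<p}. U $$ (i, l) * B $$ (l, j))"
        using U B ij by (simp add: scalar_prod_def)
      also have "\<dots> = (\<Sum>l\<in>{0..<q}. U $$ (i, l) * B $$ (l, j))"
        using False Bz ij by (intro sum.mono_neutral_right) auto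
      also have "\<dots> = (U' * B') $$ (i, j)"
        using ij by (simp add: U'_def B'_def scalar_prod_def)
      finally show "A $$ (i, j) = (U' * B') $$ (i, j)"
        by (simp add: A_UB)
    qed (auto simp: U'_def B'_def m_def n_def)
    then show ?thesis
      using vec_space.rank_mult_le[of U' m q B' n] by (simp add: U'_def B'_def m_def)
  qed
qed

section \<open>The lifting operator\<close>

text \<open>As a product with the first columns of the identity, \<open>U\<^sub>r\<close> is accessible to the cancellation
  \<open>U\<^sup>T U = 1\<close>.\<close>

lemma first_cols_eq_mult:
  assumes U: "U \<in> carrier_mat m p" and "r \<le> p"
  shows "first_cols r U = U * mat p r (\<lambda>(i, j). if i = j then 1 else 0)"
proof -
  have card: "{j. j < p \<and> j \<in> {..<r}} = {..<r}"
    using \<open>r \<le> p\<close> by auto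
  show ?thesis
  proof (rule eq_matI)
    fix i j assume "i < dim_row (U * mat p r (\<lambda>(i, j). if i = j then 1 else (0 :: real)))"
      "j < dim_col (U * mat p r (\<lambda>(i, j). if i = j then 1 else (0 :: real)))"
    then have ij: "i < m" "j < r" using U by auto
    have "{a \<in> {..<r}. a < j} = {..<j}" using ij by auto
    then have "pick {..<r} j = j"
      using pick_card_in_set[of j "{..<r}"] ij by simp
    then have "first_cols r U $$ (i, j) = U $$ (i, j)"
      unfolding first_cols_def using U ij card by (subst submatrix_index) (auto simp: pick_UNIV)
    moreover have "(U * mat p r (\<lambda>(i, j). if i = j then 1 else 0)) $$ (i, j) =
        (\<Sum>l\<in>{0..<p}. U $$ (i, l) * (if l = j then 1 else 0))"
      using U ij by (simp add: scalar_prod_def)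
    moreover have "\<dots> = (\<Sum>l\<in>{0..<p}. if l = j then U $$ (i, l) else 0)"
      by (intro sum.cong) auto
    ultimately show "first_cols r U $$ (i, j) =
        (U * mat p r (\<lambda>(i, j). if i = j then 1 else 0)) $$ (i, j)"
      using ij \<open>r \<le> p\<close> by simp
  qed (use U card in \<open>auto simp: first_cols_def dim_submatrix\<close>)
qed

lemma le_sqrt_mult:
  assumes "a\<^sup>2 \<le> c * b\<^sup>2" "0 \<le> (b :: real)"
  shows "a \<le> sqrt c * b"
  using real_le_rsqrt[OF assms(1)] assms(2) by (simp add: real_sqrt_mult)

text \<open>
  The estimates for the SVD \<open>U S V\<^sup>T\<close> of \<open>A\<^sub>c\<close> are in terms of a lower bound \<open>\<rho>\<close> on the first \<open>r\<close>
  diagonal entries \<open>s i\<close> of \<open>S\<close> and an upper bound \<open>\<sigma>\<close> on the others. For ordered singular values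
  \<open>\<sigma>\<^sub>r\<close> and \<open>\<sigma>\<^bsub>r+1\<^esub>\<close> are such bounds.
\<close>

context
  fixes Af Ac U V :: "real mat" and s :: "nat \<Rightarrow> real" and m n nc p r :: nat
  assumes Af: "Af \<in> carrier_mat m n" and U: "U \<in> carrier_mat m p" and V: "V \<in> carrier_mat nc p"
    and U_orth: "transpose_mat U * U = 1\<^sub>m p" and V_orth: "transpose_mat V * V = 1\<^sub>m p"
    and Ac_eq: "Ac = U * diag_of p s * transpose_mat V"
    and r_le: "r \<le> p" and s_pos: "\<And>i. i < r \<Longrightarrow> 0 < s i"
begin

lemma factor_dims: "dim_row Af = m" "dim_col Af = n" "dim_row U = m" "dim_col U = p"
    "dim_row V = nc" "dim_col V = p"
  using Af U V by auto

lemma U_cancel: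
  assumes X: "dim_row X = p"
  shows "transpose_mat U * (U * X) = X"
proof -
  have "transpose_mat U * (U * X) = transpose_mat U * U * X"
    by (rule mat_mult_assoc_dim[symmetric]) (simp_all add: factor_dims X)
  also have "\<dots> = X"
    unfolding U_orth by (rule left_mult_one_mat[OF carrier_matI[OF X refl]])
  finally show ?thesis .
qed

lemma V_cancel:
  assumes X: "dim_row X = p"
  shows "transpose_mat V * (V * X) = X"
proof -
  have "transpose_mat V * (V * X) = transpose_mat V * V * X"
    by (rule mat_mult_assoc_dim[symmetric]) (simp_all add: factor_dims X)
  also have "\<dots> = X"
    unfolding V_orth by (rule left_mult_one_mat[OF carrier_matI[OF X refl]])
  finally show ?thesis .
qed

lemma diag_of_mult_left: "dim_row X = p \<Longrightarrow>
    diag_of p f * (diag_of p g * X) = diag_of p (\<lambda>i. f i * g i) * X"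
  using mat_mult_assoc_dim[of "diag_of p f" "diag_of p g" X] by simp

lemma Ac_carrier: "Ac \<in> carrier_mat m nc"
  by (rule carrier_matI) (simp_all add: Ac_eq factor_dims)

text \<open>\<open>T = V S\<^sup>+ J S\<^sup>+ S U\<^sup>T A\<^sub>f\<close> after cancelling \<open>U\<^sup>T U\<close> and \<open>V\<^sup>T V\<close>, where \<open>J\<close> is the diagonal
  matrix of \<open>r\<close> ones; on the first \<open>r\<close> entries \<open>S\<^sup>+ S\<close> is the identity.\<close>

lemma lifting_op_eq:
  "lifting_op Af Ac U (diag_of p s) V r =
     V * (diag_of p (\<lambda>i. if i < r then inverse (s i) else 0) * (transpose_mat U * Af))"
proof -
  define E :: "real mat" where "E = mat p r (\<lambda>(i, j). if i = j then 1 else 0)"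
  have E: "dim_row E = p" "dim_col E = r"
    by (auto simp: E_def)
  have EE: "E * transpose_mat E = diag_of p (\<lambda>i. if i < r then 1 else 0)"
  proof (rule eq_matI)
    fix i j assume "i < dim_row (diag_of p (\<lambda>i. if i < r then 1 else 0))"
      "j < dim_col (diag_of p (\<lambda>i. if i < r then 1 else 0))"
    then have ij: "i < p" "j < p" by auto
    have "(E * transpose_mat E) $$ (i, j) =
        (\<Sum>l\<in>{0..<r}. (if i = l then 1 else 0) * (if j = l then 1 else 0))"
      using ij by (simp add: E_def scalar_prod_def)
    also have "\<dots> = (\<Sum>l\<in>{0..<r}. if i = l then if j = l then 1 else 0 else 0)"
      by (intro sum.cong) auto
    also have "\<dots> = diag_of p (\<lambda>i. if i < r then 1 else 0) $$ (i, j)"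
      using ij by (auto simp: diag_of_def)
    finally show "(E * transpose_mat E) $$ (i, j) = diag_of p (\<lambda>i. if i < r then 1 else 0) $$ (i, j)" .
  qed (auto simp: E)
  have EE_mult: "E * (transpose_mat E * X) = diag_of p (\<lambda>i. if i < r then 1 else 0) * X"
    if "dim_row X = p" for X
    using mat_mult_assoc_dim[of E "transpose_mat E" X] that E EE by simp
  have "lifting_op Af Ac U (diag_of p s) V r =
      V * (diag_of p (\<lambda>i. inverse (s i) * (if i < r then 1 else 0) * inverse (s i) * s i) *
        (transpose_mat U * Af))"
    unfolding lifting_op_def Let_def first_cols_eq_mult[OF U r_le] E_def[symmetric] pinv_diag_of Ac_eq
    by (simp add: mat_mult_assoc_dim transpose_mult_dim factor_dims E U_cancel V_cancel EE_mult
        diag_of_mult_left)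
  also have "diag_of p (\<lambda>i. inverse (s i) * (if i < r then 1 else 0) * inverse (s i) * s i) =
      diag_of p (\<lambda>i. if i < r then inverse (s i) else 0)"
    using s_pos by (intro diag_of_cong) force
  finally show ?thesis .
qed

lemma lifting_op_carrier: "lifting_op Af Ac U (diag_of p s) V r \<in> carrier_mat nc n"
  unfolding lifting_op_eq by (intro carrier_matI) (simp_all add: factor_dims)

text \<open>The lifting operator is made so that \<open>A\<^sub>c T\<close> is the projection of \<open>A\<^sub>f\<close> onto the span of the
  first \<open>r\<close> left singular vectors of \<open>A\<^sub>c\<close>.\<close>

lemma Ac_lifting_op:
  "Ac * lifting_op Af Ac U (diag_of p s) V r =
     U * (diag_of p (\<lambda>i. if i < r then 1 else 0) * (transpose_mat U * Af))"
proof -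
  have "Ac * lifting_op Af Ac U (diag_of p s) V r =
      U * (diag_of p (\<lambda>i. s i * (if i < r then inverse (s i) else 0)) * (transpose_mat U * Af))"
    unfolding lifting_op_eq unfolding Ac_eq
    by (simp add: mat_mult_assoc_dim factor_dims V_cancel diag_of_mult_left)
  also have "diag_of p (\<lambda>i. s i * (if i < r then inverse (s i) else 0)) =
      diag_of p (\<lambda>i. if i < r then 1 else 0)"
    using s_pos by (intro diag_of_cong) force
  finally show ?thesis .
qed

lemma Ac_transpose_norm:
  assumes x: "x \<in> carrier_vec m"
  shows "euclid_norm (transpose_mat Ac *\<^sub>v x) =
    euclid_norm (diag_of p s *\<^sub>v (transpose_mat U *\<^sub>v x))"
proof -
  have "transpose_mat Ac *\<^sub>v x = V *\<^sub>v (diag_of p s *\<^sub>v (transpose_mat U *\<^sub>v x))"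
    unfolding Ac_eq using x
    by (simp add: transpose_mult_dim mat_mult_assoc_dim mat_mult_vec_assoc_dim factor_dims)
  moreover have "diag_of p s *\<^sub>v (transpose_mat U *\<^sub>v x) \<in> carrier_vec p"
    by (rule carrier_vecI) simp
  ultimately show ?thesis
    using euclid_norm_orthonormal[OF V V_orth] by simp
qed

text \<open>The transposed residual maps \<open>y\<close> to \<open>A\<^sub>f\<^sup>T z\<close> with \<open>z = y - q\<close>, where \<open>q\<close> is the orthogonal
  projection of \<open>y\<close>; so \<open>\<bar>z\<bar> \<le> \<bar>y\<bar>\<close> by Pythagoras, and \<open>S U\<^sup>T z\<close> has no entries before the
  \<open>r\<close>-th.\<close>

lemma norm2_projection_residual_le:
  assumes "0 < m" "0 < \<tau>" "0 \<le> eps Af Ac \<tau>" "0 \<le> \<sigma>"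
    and s_le: "\<And>i. r \<le> i \<Longrightarrow> i < p \<Longrightarrow> \<bar>s i\<bar> \<le> \<sigma>"
  shows "norm2 (Af - Ac * lifting_op Af Ac U (diag_of p s) V r) \<le> sqrt (eps Af Ac \<tau> + \<tau> * \<sigma>\<^sup>2)"
proof (rule norm2_le_transpose[of _ m n])
  define J where "J = diag_of p (\<lambda>i. if i < r then 1 else 0)"
  let ?T = "lifting_op Af Ac U (diag_of p s) V r"
  show "Af - Ac * ?T \<in> carrier_mat m n"
    by (rule minus_carrier_mat[OF mult_carrier_mat[OF Ac_carrier lifting_op_carrier]])
  show "0 \<le> sqrt (eps Af Ac \<tau> + \<tau> * \<sigma>\<^sup>2)"
    using assms by simp
  fix y :: "real vec" assume y: "y \<in> carrier_vec m"
  define w where "w = transpose_mat U *\<^sub>v y"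
  define q where "q = U *\<^sub>v (J *\<^sub>v w)"
  define z where "z = y - q"
  have w: "w \<in> carrier_vec p" and q: "q \<in> carrier_vec m" and z: "z \<in> carrier_vec m"
    and Jw: "J *\<^sub>v w \<in> carrier_vec p"
    unfolding w_def q_def z_def J_def using y by (intro carrier_vecI; simp add: factor_dims)+
  have w_le: "euclid_norm w \<le> euclid_norm y"
    unfolding w_def by (rule euclid_norm_orthonormal_transpose_le[OF U U_orth y])
  have res: "transpose_mat (Af - Ac * ?T) *\<^sub>v y = transpose_mat Af *\<^sub>v z"
  proof -
    have c: "Af \<in> carrier_mat m n" "Ac * ?T \<in> carrier_mat m n"
      by (rule Af, rule mult_carrier_mat[OF Ac_carrier lifting_op_carrier])
    have "transpose_mat (Ac * ?T) *\<^sub>v y = transpose_mat Af *\<^sub>v q"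
      unfolding Ac_lifting_op q_def w_def J_def using y
      by (simp add: transpose_mult_dim mat_mult_assoc_dim mat_mult_vec_assoc_dim factor_dims)
    then show ?thesis
      using minus_mult_distrib_mat_vec[of "transpose_mat Af" n m "transpose_mat (Ac * ?T)" y]
        mult_minus_distrib_mat_vec[of "transpose_mat Af" n m y q] c y q
      by (simp add: transpose_minus[OF c] z_def)
  qed
  have z_le: "euclid_norm z \<le> euclid_norm y"
  proof -
    have JJ: "w \<bullet> (J *\<^sub>v w) = (J *\<^sub>v w) \<bullet> (J *\<^sub>v w)"
    proof -
      have "J * J = J"
        unfolding J_def diag_of_mult by (rule diag_of_cong) simp
      moreover have "J * J *\<^sub>v w = J *\<^sub>v (J *\<^sub>v w)"
        by (rule mat_mult_vec_assoc_dim) (use w in \<open>simp_all add: J_def\<close>)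
      ultimately have "J *\<^sub>v (J *\<^sub>v w) = J *\<^sub>v w"
        by simp
      then show ?thesis
        using transpose_vec_mult_scalar[of J p p "J *\<^sub>v w" w] w Jw by (simp add: J_def)
    qed
    have yq: "y \<bullet> q = (J *\<^sub>v w) \<bullet> (J *\<^sub>v w)"
      using transpose_vec_mult_scalar[OF U Jw y] JJ by (simp add: q_def w_def)
    have "q \<bullet> q = (J *\<^sub>v w) \<bullet> (J *\<^sub>v w)"
      using euclid_norm_orthonormal[OF U U_orth Jw] by (simp add: q_def flip: euclid_norm_square)
    then have "z \<bullet> z = y \<bullet> y - q \<bullet> q"
      using y q yq comm_scalar_prod[OF y q]
      by (simp add: z_def minus_scalar_prod_distrib[of _ m] scalar_prod_minus_distrib[of _ m])
    then have "(euclid_norm z)\<^sup>2 \<le> (euclid_norm y)\<^sup>2"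
      using scalar_prod_self_nonneg[of q] by (simp add: euclid_norm_square)
    then show ?thesis
      by (rule power2_le_imp_le) simp
  qed
  have Ac_le: "euclid_norm (transpose_mat Ac *\<^sub>v z) \<le> \<sigma> * euclid_norm y"
  proof -
    have UJ: "transpose_mat U *\<^sub>v q = J *\<^sub>v w"
      unfolding q_def by (rule orthonormal_transpose_mult_vec[OF U U_orth Jw])
    have "diag_of p s *\<^sub>v (transpose_mat U *\<^sub>v z) =
        diag_of p (\<lambda>i. if i < r then 0 else s i) *\<^sub>v w"
    proof (rule eq_vecI)
      fix i assume "i < dim_vec (diag_of p (\<lambda>i. if i < r then 0 else s i) *\<^sub>v w)"
      then have i: "i < p" by simp
      have Uz: "transpose_mat U *\<^sub>v z = w - J *\<^sub>v w"
        using mult_minus_distrib_mat_vec[of "transpose_mat U" p m y q] U y q UJ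
        by (simp add: z_def w_def)
      show "(diag_of p s *\<^sub>v (transpose_mat U *\<^sub>v z)) $ i =
          (diag_of p (\<lambda>i. if i < r then 0 else s i) *\<^sub>v w) $ i"
        unfolding Uz using i w Jw
        by (simp add: diag_of_mult_vec_index J_def del: index_mult_mat_vec)
    qed simp
    then have "euclid_norm (transpose_mat Ac *\<^sub>v z) \<le> \<sigma> * euclid_norm w"
      unfolding Ac_transpose_norm[OF z]
      using euclid_norm_diag_of_le[OF w, of "\<lambda>i. if i < r then 0 else s i" \<sigma>] s_le \<open>0 \<le> \<sigma>\<close>
      by simp
    also have "\<dots> \<le> \<sigma> * euclid_norm y"
      using w_le \<open>0 \<le> \<sigma>\<close> by (intro mult_left_mono)
    finally show ?thesis .
  qed
  have "(euclid_norm (transpose_mat Af *\<^sub>v z))\<^sup>2 \<le>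
      eps Af Ac \<tau> * (euclid_norm z)\<^sup>2 + \<tau> * (euclid_norm (transpose_mat Ac *\<^sub>v z))\<^sup>2"
    using eps_bound[OF Af Ac_carrier z \<open>0 < m\<close>] .
  also have "\<dots> \<le> eps Af Ac \<tau> * (euclid_norm y)\<^sup>2 + \<tau> * (\<sigma> * euclid_norm y)\<^sup>2"
    using z_le Ac_le assms by (intro add_mono mult_left_mono power_mono) auto
  also have "\<dots> = (eps Af Ac \<tau> + \<tau> * \<sigma>\<^sup>2) * (euclid_norm y)\<^sup>2"
    by (simp add: power_mult_distrib algebra_simps)
  finally show "euclid_norm (transpose_mat (Af - Ac * ?T) *\<^sub>v y) \<le>
      sqrt (eps Af Ac \<tau> + \<tau> * \<sigma>\<^sup>2) * euclid_norm y"
    unfolding res by (rule le_sqrt_mult) simp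
qed

text \<open>The transposed lifting operator maps \<open>y\<close> to \<open>A\<^sub>f\<^sup>T z\<close>, where \<open>z\<close> is at most \<open>1 / \<rho>\<close> times as long as
  \<open>y\<close>, and \<open>A\<^sub>c\<^sup>T z\<close> is at most as long as \<open>y\<close> since \<open>A\<^sub>c\<^sup>T\<close> undoes the division by the singular
  values.\<close>

lemma norm2_lifting_op_le:
  assumes "0 < m" "0 < \<tau>" "0 \<le> eps Af Ac \<tau>" "0 < \<rho>"
    and s_ge: "\<And>i. i < r \<Longrightarrow> \<rho> \<le> s i"
  shows "norm2 (lifting_op Af Ac U (diag_of p s) V r) \<le> sqrt (\<tau> + eps Af Ac \<tau> / \<rho>\<^sup>2)"
proof (rule norm2_le_transpose[OF lifting_op_carrier])
  let ?T = "lifting_op Af Ac U (diag_of p s) V r"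
  show "0 \<le> sqrt (\<tau> + eps Af Ac \<tau> / \<rho>\<^sup>2)"
    using assms by simp
  fix y :: "real vec" assume y: "y \<in> carrier_vec nc"
  define g where "g = (\<lambda>i. if i < r then inverse (s i) else 0)"
  define w where "w = transpose_mat V *\<^sub>v y"
  define z where "z = U *\<^sub>v (diag_of p g *\<^sub>v w)"
  have w: "w \<in> carrier_vec p" and gw: "diag_of p g *\<^sub>v w \<in> carrier_vec p"
    and z: "z \<in> carrier_vec m"
    unfolding w_def z_def by (intro carrier_vecI; simp add: factor_dims)+
  have w_le: "euclid_norm w \<le> euclid_norm y"
    unfolding w_def by (rule euclid_norm_orthonormal_transpose_le[OF V V_orth y])
  have lift: "transpose_mat ?T *\<^sub>v y = transpose_mat Af *\<^sub>v z"
    unfolding lifting_op_eq z_def w_def g_def using y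
    by (simp add: transpose_mult_dim mat_mult_assoc_dim mat_mult_vec_assoc_dim factor_dims)
  have "euclid_norm z = euclid_norm (diag_of p g *\<^sub>v w)"
    unfolding z_def by (rule euclid_norm_orthonormal[OF U U_orth gw])
  also have "\<dots> \<le> inverse \<rho> * euclid_norm w"
  proof (rule euclid_norm_diag_of_le[OF w])
    fix i show "\<bar>g i\<bar> \<le> inverse \<rho>"
      using s_ge[of i] \<open>0 < \<rho>\<close> by (auto simp: g_def)
  qed (use \<open>0 < \<rho>\<close> in simp)
  also have "\<dots> \<le> inverse \<rho> * euclid_norm y"
    using w_le \<open>0 < \<rho>\<close> by (intro mult_left_mono) auto
  finally have z_le: "euclid_norm z \<le> inverse \<rho> * euclid_norm y" .
  have Uz: "transpose_mat U *\<^sub>v z = diag_of p g *\<^sub>v w"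
    unfolding z_def by (rule orthonormal_transpose_mult_vec[OF U U_orth gw])
  have "diag_of p s *\<^sub>v (diag_of p g *\<^sub>v w) = diag_of p (\<lambda>i. s i * g i) *\<^sub>v w"
    using mat_mult_vec_assoc_dim[of "diag_of p s" "diag_of p g" w] w by simp
  then have "euclid_norm (transpose_mat Ac *\<^sub>v z) = euclid_norm (diag_of p (\<lambda>i. s i * g i) *\<^sub>v w)"
    unfolding Ac_transpose_norm[OF z] Uz by simp
  also have "\<dots> \<le> 1 * euclid_norm w"
  proof (rule euclid_norm_diag_of_le[OF w])
    fix i show "\<bar>s i * g i\<bar> \<le> 1"
      using s_pos[of i] by (auto simp: g_def)
  qed simp
  finally have Ac_le: "euclid_norm (transpose_mat Ac *\<^sub>v z) \<le> euclid_norm y"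
    using w_le by simp
  have "(euclid_norm (transpose_mat Af *\<^sub>v z))\<^sup>2 \<le>
      eps Af Ac \<tau> * (euclid_norm z)\<^sup>2 + \<tau> * (euclid_norm (transpose_mat Ac *\<^sub>v z))\<^sup>2"
    using eps_bound[OF Af Ac_carrier z \<open>0 < m\<close>] .
  also have "\<dots> \<le> eps Af Ac \<tau> * (inverse \<rho> * euclid_norm y)\<^sup>2 + \<tau> * (euclid_norm y)\<^sup>2"
    using z_le Ac_le assms by (intro add_mono mult_left_mono power_mono) auto
  also have "\<dots> = (\<tau> + eps Af Ac \<tau> / \<rho>\<^sup>2) * (euclid_norm y)\<^sup>2"
    by (simp add: power_mult_distrib power_inverse divide_inverse algebra_simps)
  finally show "euclid_norm (transpose_mat ?T *\<^sub>v y) \<le>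
      sqrt (\<tau> + eps Af Ac \<tau> / \<rho>\<^sup>2) * euclid_norm y"
    unfolding lift by (rule le_sqrt_mult) simp
qed

end

section \<open>The error bound\<close>

text \<open>The two summands of the bound are the contributions of lifting \<open>A\<^sub>c\<close> itself and of lifting the
  error of its row interpolative decomposition.\<close>

lemma spc_id_error_le:
  assumes Af: "Af \<in> carrier_mat m n" and Ac: "Ac \<in> carrier_mat m nc"
    and svd: "is_svd Ac U S V" and row_ID: "is_row_ID k Ac I P"
    and r: "1 \<le> r" "r \<le> vec_space.rank m Ac" and \<tau>: "\<tau> \<in> admissible_taus Af Ac"
  shows "norm2 (Af - spc_id Af Ac U S V I P r) \<le> error_bound Af Ac S I P \<tau> r"
proof -
  define p where "p = min m nc"
  define s where "s = (\<lambda>i. S $$ (i, i))"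
  have U: "U \<in> carrier_mat m p" and S: "S \<in> carrier_mat p p" and V: "V \<in> carrier_mat nc p"
    and U_orth: "transpose_mat U * U = 1\<^sub>m p" and V_orth: "transpose_mat V * V = 1\<^sub>m p"
    and diag: "diagonal_mat S" and Ac_eq: "Ac = U * S * transpose_mat V"
    and nonneg: "\<And>i. i < p \<Longrightarrow> 0 \<le> s i"
    and dec: "\<And>i j. i \<le> j \<Longrightarrow> j < p \<Longrightarrow> s j \<le> s i"
    using is_svdD[OF svd Ac p_def] unfolding s_def by blast+
  have S_eq: "S = diag_of p s"
    unfolding s_def by (rule diagonal_mat_eq_diag_of[OF S diag])
  have "sing_val S r \<noteq> 0"
    using rank_le_of_sing_val_zero[OF svd, of "r - 1"] r Ac by auto
  then have "r \<le> p" and \<rho>_eq: "sing_val S r = s (r - 1)"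
    using S by (auto simp: sing_val_def s_def split: if_splits)
  have "r - 1 < p"
    using \<open>r \<le> p\<close> \<open>1 \<le> r\<close> by linarith
  have \<rho>: "0 < sing_val S r"
    using \<open>sing_val S r \<noteq> 0\<close> nonneg[OF \<open>r - 1 < p\<close>] unfolding \<rho>_eq by simp
  have s_ge: "sing_val S r \<le> s i" if "i < r" for i
    unfolding \<rho>_eq by (rule dec) (use that \<open>r - 1 < p\<close> in linarith)+
  have s_pos: "0 < s i" if "i < r" for i
    using s_ge[OF that] \<rho> by simp
  have \<sigma>: "0 \<le> sing_val S (r + 1)"
    using S nonneg by (auto simp: sing_val_def s_def)
  have s_le: "\<bar>s i\<bar> \<le> sing_val S (r + 1)" if "r \<le> i" "i < p" for i
    using that S nonneg[of i] dec[of r i] by (auto simp: sing_val_def s_def)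
  have "0 < m"
    using r \<open>r \<le> p\<close> by (auto simp: p_def)
  have \<tau>': "0 < \<tau>" "0 \<le> eps Af Ac \<tau>"
    using \<tau> by (auto simp: admissible_taus_def)
  define T where "T = lifting_op Af Ac U S V r"
  define R where "R = P * select_rows Ac I"
  note ctx = Af U V U_orth V_orth Ac_eq[unfolded S_eq] \<open>r \<le> p\<close> s_pos
  have T: "T \<in> carrier_mat nc n"
    unfolding T_def S_eq by (rule lifting_op_carrier[OF ctx])
  have R: "R \<in> carrier_mat m nc"
  proof -
    have "{i. i < m \<and> i \<in> I} = I"
      using row_ID Ac by (auto simp: is_row_ID_def)
    then show ?thesis
      using row_ID Ac by (intro carrier_matI)
        (auto simp: R_def is_row_ID_def select_rows_def dim_submatrix)
  qed
  have "Af - spc_id Af Ac U S V I P r = (Af - Ac * T) + (Ac - R) * T"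
    unfolding spc_id_def T_def[symmetric] R_def[symmetric]
    unfolding minus_mult_distrib_mat[OF Ac R T]
    using Af Ac R T by (intro eq_matI) auto
  moreover have E: "Af - Ac * T \<in> carrier_mat m n" and F: "Ac - R \<in> carrier_mat m nc"
    by (rule minus_carrier_mat[OF mult_carrier_mat[OF Ac T]], rule minus_carrier_mat[OF R])
  ultimately have "norm2 (Af - spc_id Af Ac U S V I P r) \<le>
      norm2 (Af - Ac * T) + norm2 ((Ac - R) * T)"
    using norm2_add_le[OF E mult_carrier_mat[OF F T]] by simp
  also have "\<dots> \<le> norm2 (Af - Ac * T) + norm2 (Ac - R) * norm2 T"
    using norm2_mult_le[OF F T] by simp
  also have "\<dots> \<le> error_bound Af Ac S I P \<tau> r"
    unfolding error_bound_def R_def[symmetric]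
  proof (intro add_mono mult_left_mono norm2_nonneg)
    show "norm2 (Af - Ac * T) \<le> sqrt (eps Af Ac \<tau> + \<tau> * (sing_val S (r + 1))\<^sup>2)"
      unfolding T_def
      using norm2_projection_residual_le[OF ctx \<open>0 < m\<close> \<tau>' \<sigma> s_le] S_eq by simp
    show "norm2 T \<le> sqrt (\<tau> + eps Af Ac \<tau> / (sing_val S r)\<^sup>2)"
      unfolding T_def
      using norm2_lifting_op_le[OF ctx \<open>0 < m\<close> \<tau>' \<rho> s_ge] S_eq by simp
  qed
  finally show ?thesis .
qed

lemma error_bound_nonneg:
  assumes "\<tau> \<in> admissible_taus Af Ac"
  shows "0 \<le> error_bound Af Ac S I P \<tau> r"
  using assms by (auto simp: error_bound_def admissible_taus_def norm2_nonneg)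

theorem theorem4p1:
  fixes Af D Ac Uc Sc Vc Pc :: "real mat" and Ic :: "nat set" and m n nc k r :: nat
  assumes "Af \<in> carrier_mat m n"
    and "D \<in> carrier_mat n nc"
    and "Ac = Af * D"
    and "is_svd Ac Uc Sc Vc"
    and "1 \<le> k"
    and "is_row_ID k Ac Ic Pc"
    and "is_arg_min (\<lambda>r'. INF \<tau> \<in> admissible_taus Af Ac. error_bound Af Ac Sc Ic Pc \<tau> r')
           (\<lambda>r'. k \<le> r' \<and> r' \<le> vec_space.rank m Ac) r"
  shows "norm2 (Af - spc_id Af Ac Uc Sc Vc Ic Pc r)
           \<le> (INF (\<tau>, r') \<in> admissible_taus Af Ac \<times> {k..vec_space.rank m Ac}.
                error_bound Af Ac Sc Ic Pc \<tau> r')"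
proof -
  let ?b = "\<lambda>r'. INF \<tau> \<in> admissible_taus Af Ac. error_bound Af Ac Sc Ic Pc \<tau> r'"
  have Ac: "Ac \<in> carrier_mat m nc"
    using assms(1-3) by simp
  have r: "k \<le> r" "r \<le> vec_space.rank m Ac"
    using assms(7) by (auto simp: is_arg_min_def)
  have min: "?b r \<le> ?b r'" if "k \<le> r'" "r' \<le> vec_space.rank m Ac" for r'
    using assms(7) that by (auto simp: is_arg_min_def not_less)
  have rank: "1 \<le> vec_space.rank m Ac"
    using r \<open>1 \<le> k\<close> by simp
  \<comment> \<open>\<open>A\<^sub>c\<close> has positive rank, and a zero matrix factors through dimension \<open>0\<close>.\<close>
  have nz: "Af \<noteq> 0\<^sub>m m n"
  proof
    assume "Af = 0\<^sub>m m n"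
    then have "Ac = 0\<^sub>m m 0 * 0\<^sub>m 0 nc"
      using assms(2,3) by (intro eq_matI) (auto simp: scalar_prod_def)
    then show False
      using rank vec_space.rank_mult_le[of "0\<^sub>m m 0 :: real mat" m 0 "0\<^sub>m 0 nc" nc] by simp
  qed
  have "0 < m"
  proof (rule ccontr)
    assume "\<not> 0 < m"
    then show False
      using nz assms(1) by (auto intro!: eq_matI)
  qed
  have taus: "admissible_taus Af Ac \<noteq> {}"
    by (rule admissible_taus_nonempty[OF assms(1) Ac \<open>0 < m\<close> nz])
  have bdd: "bdd_below ((\<lambda>\<tau>. error_bound Af Ac Sc Ic Pc \<tau> r') ` admissible_taus Af Ac)" for r'
    using error_bound_nonneg by (intro bdd_belowI2)
  show ?thesis
  proof (rule cINF_greatest)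
    show "admissible_taus Af Ac \<times> {k..vec_space.rank m Ac} \<noteq> {}"
      using taus r by auto
  next
    fix x assume "x \<in> admissible_taus Af Ac \<times> {k..vec_space.rank m Ac}"
    then obtain \<tau> r' where x: "x = (\<tau>, r')" "\<tau> \<in> admissible_taus Af Ac"
        "k \<le> r'" "r' \<le> vec_space.rank m Ac"
      by auto
    have "norm2 (Af - spc_id Af Ac Uc Sc Vc Ic Pc r) \<le> ?b r"
      using spc_id_error_le[OF assms(1) Ac assms(4,6)] r \<open>1 \<le> k\<close> taus
      by (intro cINF_greatest) auto
    also have "\<dots> \<le> ?b r'"
      using min x by simp
    also have "\<dots> \<le> error_bound Af Ac Sc Ic Pc \<tau> r'"
      using bdd x(2) by (rule cINF_lower)
    finally show "norm2 (Af - spc_id Af Ac Uc Sc Vc Ic Pc r) \<le>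
        (case x of (\<tau>, r') \<Rightarrow> error_bound Af Ac Sc Ic Pc \<tau> r')"
      using x by simp
  qed
qed

end
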